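(* If $x\neq\emptyset$ is a finite configuration of $[\![C]\!]$ with a covering chain $\emptyset\subset x_1\subset\cdots\subset x_n=x$ whose sequence of added events (read through their labels, with event $\tau_b^n$ read as $P_b^n$) is the word $\omega$, then there exists $C'$ such that $C \overset{\omega}{\twoheadrightarrow} C'$.
   Context: Quantum commands over $N$ qubits: $C ::= \mathtt{skip} \mid U(\vec n) \mid C;C \mid \mathtt{meas}\ n\ C_1\ C_2 \mid C\parallel C$, where $U(\vec n)$ applies unitary $U$ to qubits $\vec n$, $\mathtt{meas}\ n\ C_1\ C_2$ measures qubit $n$ and continues with $C_1$ after projection $P_0^n$ and with $C_2$ after $P_1^n$, and $C_1\parallel C_2$ requires disjoint qubit sets. Labels: $sk$, $U(\vec n)$, $P_0^n$, $P_1^n$. Small steps: $\mathtt{skip}\xrightarrow{sk}\checkmark$, $U(\vec n)\xrightarrow{U(\vec n)}\checkmark$, $\mathtt{meas}\ n\ C_1\ C_2\xrightarrow{P_0^n}C_1$ and $\xrightarrow{P_1^n}C_2$; sequential and parallel composition as usual (left component of $;$ moves, reaching $\checkmark$ leaves $C_2$; either side of $\parallel$ moves, a finished side is dropped). Multi-step: $C\overset{l}{\twoheadrightarrow}C'$ if $C\xrightarrow{l}C'$; $C\overset{l:\omega'}{\twoheadrightarrow}C'$ if $C\xrightarrow{l}C''\overset{\omega'}{\twoheadrightarrow}C'$. A unitary event structure is an event structure $(E,\le,\#)$ (partial order with finite down-closures, hereditary conflict; configurations are conflict-free down-closed sets) with a map $Q$ from events to unitary or projection operators such that concurrent events have commuting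 operators, minimal conflict is transitive, and the sum of $Q$ over each minimal-conflict class is unitary. Interpretation $[\![C]\!]$: $[\![\mathtt{skip}]\!]$ is one event $sk$ with $Q=Id$; $[\![U(\vec n)]\!]$ is one event with $Q=U(\vec n)$; $[\![C_1;C_2]\!]$ has events $E_1\uplus(E_2\times$ maximal configurations of $[\![C_1]\!])$, with $e_1\le(e_2,x)$ for $e_1\in x$ and $Q$ inherited; $[\![\mathtt{meas}\ n\ C_1\ C_2]\!]$ has new events $\tau_0^n,\tau_1^n$ (with $Q=P_0^n,P_1^n$) in conflict, $\tau_0^n$ below all events of $[\![C_1]\!]$ and $\tau_1^n$ below all of $[\![C_2]\!]$, everything on the $\tau_0^n$ side in conflict with everything on the $\tau_1^n$ side; $[\![C_1\parallel C_2]\!]$ is the disjoint union. A covering chain of $x$ is a chain $\emptyset\subset x_1\subset\cdots\subset x_n=x$ of configurations each adding one event. *)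

theory Defs
  imports
    "HOL-Library.FSet"
    "Jordan_Normal_Form.Matrix"
    "Jordan_Normal_Form.Schur_Decomposition"
begin

subsection \<open>Operators on \<open>N\<close> qubits\<close>

text \<open>
  The qubits are \<open>0, \<dots>, N - 1\<close> and operators are complex matrices of size \<open>2 ^ N\<close>. The basis
  vector with index \<open>i < 2 ^ N\<close> is the one in which qubit \<open>m\<close> has the value \<open>bit i m\<close>.
\<close>

definition unitary_mat :: "nat \<Rightarrow> complex mat \<Rightarrow> bool" where
  "unitary_mat d A \<longleftrightarrow>
     A \<in> carrier_mat d d \<and> A * mat_adjoint A = 1\<^sub>m d \<and> mat_adjoint A * A = 1\<^sub>m d"

definition projection_mat :: "nat \<Rightarrow> complex mat \<Rightarrow> bool" where
  "projection_mat d A \<longleftrightarrow> A \<in> carrier_mat d d \<and> A * A = A \<and> mat_adjoint A = A"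

text \<open>
  The index, among the \<open>2 ^ length ns\<close> basis vectors of the qubits \<open>ns\<close> alone, of the restriction
  of the \<open>i\<close>-th basis vector. As for the whole register, the \<open>k\<close>-th qubit of the list \<open>ns\<close> is
  the \<open>k\<close>-th bit, the least significant bit coming first.
\<close>

definition sub_index :: "nat list \<Rightarrow> nat \<Rightarrow> nat" where
  "sub_index ns i = horner_sum of_bool 2 (map (bit i) ns)"

text \<open>The gate \<open>U\<close> on the qubits \<open>ns\<close>, tensored with the identity on the other qubits.\<close>

definition gate_op :: "nat \<Rightarrow> complex mat \<Rightarrow> nat list \<Rightarrow> complex mat" where
  "gate_op N U ns = mat (2 ^ N) (2 ^ N) (\<lambda>(i, j).
     if \<forall>m<N. m \<notin> set ns \<longrightarrow> bit i m = bit j m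
     then U $$ (sub_index ns i, sub_index ns j) else 0)"

text \<open>\<open>P\<^sub>b\<^sup>n\<close>; outcome 0 is \<open>b = False\<close>, outcome 1 is \<open>b = True\<close>.\<close>

definition proj_op :: "nat \<Rightarrow> bool \<Rightarrow> nat \<Rightarrow> complex mat" where
  "proj_op N b n = mat (2 ^ N) (2 ^ N) (\<lambda>(i, j). if i = j \<and> bit i n = b then 1 else 0)"


subsection \<open>Commands and their operational semantics\<close>

datatype command =
    Skip
  | Gate "complex mat" "nat list"
  | Seq command command
  | Meas nat command command
  | Par command command

primrec qubits :: "command \<Rightarrow> nat set" where
  "qubits Skip = {}"
| "qubits (Gate U ns) = set ns"
| "qubits (Seq C1 C2) = qubits C1 \<union> qubits C2"
| "qubits (Meas n C1 C2) = insert n (qubits C1 \<union> qubits C2)"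
| "qubits (Par C1 C2) = qubits C1 \<union> qubits C2"

primrec wf_command :: "nat \<Rightarrow> command \<Rightarrow> bool" where
  "wf_command N Skip \<longleftrightarrow> True"
| "wf_command N (Gate U ns) \<longleftrightarrow>
     distinct ns \<and> set ns \<subseteq> {..<N} \<and> unitary_mat (2 ^ length ns) U"
| "wf_command N (Seq C1 C2) \<longleftrightarrow> wf_command N C1 \<and> wf_command N C2"
| "wf_command N (Meas n C1 C2) \<longleftrightarrow> n < N \<and> wf_command N C1 \<and> wf_command N C2"
| "wf_command N (Par C1 C2) \<longleftrightarrow>
     wf_command N C1 \<and> wf_command N C2 \<and> qubits C1 \<inter> qubits C2 = {}"

datatype label =
    LSkip
  | LGate "complex mat" "nat list"
  | LProj bool nat

text \<open>The target of a transition is a command (\<open>Some C'\<close>) or the terminated state \<open>\<checkmark>\<close> (\<open>None\<close>).\<close>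

inductive step :: "command \<Rightarrow> label \<Rightarrow> command option \<Rightarrow> bool" where
  step_skip: "step Skip LSkip None"
| step_gate: "step (Gate U ns) (LGate U ns) None"
| step_meas0: "step (Meas n C1 C2) (LProj False n) (Some C1)"
| step_meas1: "step (Meas n C1 C2) (LProj True n) (Some C2)"
| step_seq: "step C1 l (Some C1') \<Longrightarrow> step (Seq C1 C2) l (Some (Seq C1' C2))"
| step_seq_done: "step C1 l None \<Longrightarrow> step (Seq C1 C2) l (Some C2)"
| step_parL: "step C1 l (Some C1') \<Longrightarrow> step (Par C1 C2) l (Some (Par C1' C2))"
| step_parL_done: "step C1 l None \<Longrightarrow> step (Par C1 C2) l (Some C2)"
| step_parR: "step C2 l (Some C2') \<Longrightarrow> step (Par C1 C2) l (Some (Par C1 C2'))"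
| step_parR_done: "step C2 l None \<Longrightarrow> step (Par C1 C2) l (Some C1)"

inductive steps :: "command \<Rightarrow> label list \<Rightarrow> command option \<Rightarrow> bool" where
  steps_one: "step C l R \<Longrightarrow> steps C [l] R"
| steps_more: "step C l (Some C'') \<Longrightarrow> steps C'' w R \<Longrightarrow> steps C (l # w) R"


subsection \<open>Unitary event structures\<close>

record 'e es =
  events :: "'e set"
  causal :: "'e rel"
  conflict :: "'e rel"

record 'e ues = "'e es" +
  oper :: "'e \<Rightarrow> complex mat"

definition event_structure :: "('e, 'm) es_scheme \<Rightarrow> bool" where
  "event_structure S \<longleftrightarrow>
     partial_order_on (events S) (causal S) \<and>
     (\<forall>e\<in>events S. finite {d. (d, e) \<in> causal S}) \<and>
     conflict S \<subseteq> events S \<times> events S \<and> irrefl (conflict S) \<and> sym (conflict S) \<and>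
     (\<forall>e d d'. (e, d) \<in> conflict S \<and> (d, d') \<in> causal S \<longrightarrow> (e, d') \<in> conflict S)"

definition configuration :: "('e, 'm) es_scheme \<Rightarrow> 'e set \<Rightarrow> bool" where
  "configuration S x \<longleftrightarrow>
     x \<subseteq> events S \<and>
     (\<forall>e\<in>x. \<forall>d. (d, e) \<in> causal S \<longrightarrow> d \<in> x) \<and>
     (\<forall>e\<in>x. \<forall>d\<in>x. (e, d) \<notin> conflict S)"

definition maximal_configuration :: "('e, 'm) es_scheme \<Rightarrow> 'e set \<Rightarrow> bool" where
  "maximal_configuration S x \<longleftrightarrow>
     configuration S x \<and> (\<forall>y. configuration S y \<and> x \<subseteq> y \<longrightarrow> y = x)"

text \<open>
  \<open>xs = [\<emptyset>, x\<^sub>1, \<dots>, x\<^sub>n]\<close> is the chain of configurations and \<open>es = [e\<^sub>1, \<dots>, e\<^sub>n]\<close> is the sequence of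
  added events, \<open>e\<^sub>i\<close> being the one that leads from \<open>x\<^bsub>i-1\<^esub>\<close> to \<open>x\<^sub>i\<close>.
\<close>

definition covering_chain ::
  "('e, 'm) es_scheme \<Rightarrow> 'e set list \<Rightarrow> 'e list \<Rightarrow> 'e set \<Rightarrow> bool" where
  "covering_chain S xs es x \<longleftrightarrow>
     length xs = Suc (length es) \<and> hd xs = {} \<and> last xs = x \<and>
     (\<forall>y\<in>set xs. configuration S y) \<and>
     (\<forall>i<length es. es ! i \<notin> xs ! i \<and> xs ! Suc i = insert (es ! i) (xs ! i))"

definition concurrent :: "('e, 'm) es_scheme \<Rightarrow> 'e \<Rightarrow> 'e \<Rightarrow> bool" where
  "concurrent S e e' \<longleftrightarrow> e \<in> events S \<and> e' \<in> events S \<and>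
     (e, e') \<notin> causal S \<and> (e', e) \<notin> causal S \<and> (e, e') \<notin> conflict S"

definition minimal_conflict :: "('e, 'm) es_scheme \<Rightarrow> 'e \<Rightarrow> 'e \<Rightarrow> bool" where
  "minimal_conflict S e e' \<longleftrightarrow> (e, e') \<in> conflict S \<and>
     (\<forall>d d'. (d, e) \<in> causal S \<and> (d', e') \<in> causal S \<and> (d, d') \<in> conflict S \<longrightarrow>
        d = e \<and> d' = e')"

text \<open>
  Conflict is irreflexive, so transitivity of minimal conflict is that of its reflexive closure,
  and the classes are those of this equivalence relation.
\<close>

definition conflict_class :: "('e, 'm) es_scheme \<Rightarrow> 'e \<Rightarrow> 'e set" where
  "conflict_class S e = insert e {e'. minimal_conflict S e e'}"

definition unitary_event_structure :: "nat \<Rightarrow> ('e, 'm) ues_scheme \<Rightarrow> bool" where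
  "unitary_event_structure N S \<longleftrightarrow>
     event_structure S \<and>
     (\<forall>e\<in>events S. unitary_mat (2 ^ N) (oper S e) \<or> projection_mat (2 ^ N) (oper S e)) \<and>
     (\<forall>e e'. concurrent S e e' \<longrightarrow> oper S e * oper S e' = oper S e' * oper S e) \<and>
     (\<forall>e e' e''. minimal_conflict S e e' \<and> minimal_conflict S e' e'' \<longrightarrow>
        e = e'' \<or> minimal_conflict S e e'') \<and>
     (\<forall>e\<in>events S. unitary_mat (2 ^ N)
        (mat (2 ^ N) (2 ^ N) (\<lambda>(i, j). \<Sum>d\<in>conflict_class S e. oper S d $$ (i, j))))"


subsection \<open>Interpretation of commands\<close>

text \<open>
  \<open>ProjE b n\<close> is \<open>\<tau>\<^sub>b\<^sup>n\<close>. The other constructors tag the events of the components of a compound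
  command; \<open>SeqR e X\<close> is the pair of an event \<open>e\<close> of the second component and a maximal
  configuration \<open>X\<close> of the first. The type \<open>fset\<close> (a datatype cannot recurse through \<open>set\<close>)
  loses no configuration, since the structures are finite, see \<open>finite_events_interp\<close>.
\<close>

datatype event =
    SkipE
  | GateE "complex mat" "nat list"
  | ProjE bool nat
  | Branch bool event
  | SeqL event
  | SeqR event "event fset"
  | ParL event
  | ParR event

primrec event_label :: "event \<Rightarrow> label" where
  "event_label SkipE = LSkip"
| "event_label (GateE U ns) = LGate U ns"
| "event_label (ProjE b n) = LProj b n"
| "event_label (Branch b e) = event_label e"
| "event_label (SeqL e) = event_label e"
| "event_label (SeqR e X) = event_label e"
| "event_label (ParL e) = event_label e"
| "event_label (ParR e) = event_label e"

definition single_ues :: "event \<Rightarrow> complex mat \<Rightarrow> event ues" where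
  "single_ues e A = \<lparr>events = {e}, causal = {(e, e)}, conflict = {}, oper = (\<lambda>_. A)\<rparr>"

text \<open>
  The conflict relation is the hereditary one generated by those of the two components: conflicts
  in the first component propagate along \<open>SeqL a \<le> SeqR e X\<close> for \<open>a \<in> X\<close>.
\<close>

definition seq_ues :: "event ues \<Rightarrow> event ues \<Rightarrow> event ues" where
  "seq_ues S1 S2 = (let M = {X. maximal_configuration S1 (fset X)} in
   \<lparr>events = SeqL ` events S1 \<union> {SeqR e X | e X. e \<in> events S2 \<and> X \<in> M},
    causal =
      {(SeqL a, SeqL b) | a b. (a, b) \<in> causal S1} \<union>
      {(SeqL a, SeqR e X) | a e X. a |\<in>| X \<and> e \<in> events S2 \<and> X \<in> M} \<union>
      {(SeqR d X, SeqR e X) | d e X. (d, e) \<in> causal S2 \<and> X \<in> M},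
    conflict =
      {(SeqL a, SeqL b) | a b. (a, b) \<in> conflict S1} \<union>
      {(SeqL a, SeqR e X) | a e X. e \<in> events S2 \<and> X \<in> M \<and> (\<exists>b. b |\<in>| X \<and> (a, b) \<in> conflict S1)} \<union>
      {(SeqR e X, SeqL a) | a e X. e \<in> events S2 \<and> X \<in> M \<and> (\<exists>b. b |\<in>| X \<and> (b, a) \<in> conflict S1)} \<union>
      {(SeqR d X, SeqR e X) | d e X. (d, e) \<in> conflict S2 \<and> X \<in> M} \<union>
      {(SeqR d X, SeqR e Y) | d e X Y. d \<in> events S2 \<and> e \<in> events S2 \<and> X \<in> M \<and> Y \<in> M \<and>
         (\<exists>a b. a |\<in>| X \<and> b |\<in>| Y \<and> (a, b) \<in> conflict S1)},
    oper = (\<lambda>e. case e of SeqL a \<Rightarrow> oper S1 a | SeqR d X \<Rightarrow> oper S2 d | _ \<Rightarrow> undefined)\<rparr>)"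

definition meas_ues :: "nat \<Rightarrow> nat \<Rightarrow> event ues \<Rightarrow> event ues \<Rightarrow> event ues" where
  "meas_ues N n S1 S2 = (let
     S = (\<lambda>b. if b then S2 else S1);
     side = (\<lambda>b. insert (ProjE b n) (Branch b ` events (S b))) in
   \<lparr>events = side False \<union> side True,
    causal = (\<Union>b.
      {(ProjE b n, e) | e. e \<in> side b} \<union>
      {(Branch b d, Branch b e) | d e. (d, e) \<in> causal (S b)}),
    conflict =
      side False \<times> side True \<union> side True \<times> side False \<union>
      (\<Union>b. {(Branch b d, Branch b e) | d e. (d, e) \<in> conflict (S b)}),
    oper = (\<lambda>e. case e of ProjE b m \<Rightarrow> proj_op N b m | Branch b d \<Rightarrow> oper (S b) d
      | _ \<Rightarrow> undefined)\<rparr>)"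

definition par_ues :: "event ues \<Rightarrow> event ues \<Rightarrow> event ues" where
  "par_ues S1 S2 =
   \<lparr>events = ParL ` events S1 \<union> ParR ` events S2,
    causal =
      {(ParL d, ParL e) | d e. (d, e) \<in> causal S1} \<union>
      {(ParR d, ParR e) | d e. (d, e) \<in> causal S2},
    conflict =
      {(ParL d, ParL e) | d e. (d, e) \<in> conflict S1} \<union>
      {(ParR d, ParR e) | d e. (d, e) \<in> conflict S2},
    oper = (\<lambda>e. case e of ParL d \<Rightarrow> oper S1 d | ParR d \<Rightarrow> oper S2 d | _ \<Rightarrow> undefined)\<rparr>"

primrec interp :: "nat \<Rightarrow> command \<Rightarrow> event ues" where
  "interp N Skip = single_ues SkipE (1\<^sub>m (2 ^ N))"
| "interp N (Gate U ns) = single_ues (GateE U ns) (gate_op N U ns)"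
| "interp N (Seq C1 C2) = seq_ues (interp N C1) (interp N C2)"
| "interp N (Meas n C1 C2) = meas_ues N n (interp N C1) (interp N C2)"
| "interp N (Par C1 C2) = par_ues (interp N C1) (interp N C2)"

lemma finite_events_interp: "finite (events (interp N C))"
proof (induction C)
  case (Seq C1 C2)
  let ?M = "{X. maximal_configuration (interp N C1) (fset X)}"
  have "fset ` ?M \<subseteq> Pow (events (interp N C1))"
    by (auto simp: maximal_configuration_def configuration_def)
  then have "finite (fset ` ?M)"
    using Seq.IH(1) by (meson finite_Pow_iff finite_subset)
  then have "finite ?M"
    by (rule finite_imageD) (simp add: fset_inject inj_on_def)
  then have "finite ((\<lambda>(e, X). SeqR e X) ` (events (interp N C2) \<times> ?M))"
    using Seq.IH(2) by blast
  moreover have "{SeqR e X | e X. e \<in> events (interp N C2) \<and> X \<in> ?M}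
      = (\<lambda>(e, X). SeqR e X) ` (events (interp N C2) \<times> ?M)"
    by auto
  ultimately show ?case
    using Seq.IH(1) by (simp add: seq_ues_def Let_def)
qed (auto simp: single_ues_def meas_ues_def par_ues_def Let_def)

end

theory Submission
  imports Defs
begin

text \<open>
  By induction on \<open>C\<close>, every sequence of events whose prefixes are configurations is matched by a
  run of \<open>C\<close>, and the run terminates if the sequence exhausts a maximal configuration. The latter
  clause is what sequential composition needs: an event \<open>SeqR e X\<close> has the maximal configuration
  \<open>X\<close> below it, so it can only occur once the first component has been run to completion.
\<close>

section \<open>Runs of commands, and how they combine under the command constructors\<close>

text \<open>Unlike \<open>steps\<close>, this includes the empty run, and it grows at the end, as traces do.\<close>

inductive run :: "command \<Rightarrow> label list \<Rightarrow> command option \<Rightarrow> bool" where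
  run_Nil: "run C [] (Some C)"
| run_snoc: "run C w (Some C') \<Longrightarrow> step C' l R \<Longrightarrow> run C (w @ [l]) R"

inductive_cases run_NilE: "run C [] R"
inductive_cases run_snocE: "run C (w @ [l]) R"

text \<open>Runs grow at the end, so a step at the front needs an induction. It supplies the initial
  projection step of a measurement.\<close>

lemma run_Cons: "run C' w R \<Longrightarrow> step C l (Some C') \<Longrightarrow> run C (l # w) R"
proof (induction rule: run.induct)
  case (run_Nil C')
  then show ?case
    using run_snoc[OF run.run_Nil] by fastforce
next
  case (run_snoc C' w C'' l' R)
  then show ?case
    using run.run_snoc by fastforce
qed

text \<open>The induction is on the second run, whose steps are appended one by one to the
  first.\<close>

lemma run_append: "run C' w' R \<Longrightarrow> run C w (Some C') \<Longrightarrow> run C (w @ w') R"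
proof (induction rule: run.induct)
  case (run_snoc C' w' C'' l R)
  then show ?case
    using run.run_snoc[of C "w @ w'"] by simp
qed simp

text \<open>Each step of the first component lifts to the whole. The result is never
  \<open>None\<close>: when the first component terminates, the second is still to be run.\<close>

lemma run_Seq:
  "run C1 w R \<Longrightarrow>
   run (Seq C1 C2) w (Some (case R of None \<Rightarrow> C2 | Some C1' \<Rightarrow> Seq C1' C2))"
proof (induction rule: run.induct)
  case (run_Nil C)
  then show ?case
    by (simp add: run.run_Nil)
next
  case (run_snoc C w C' l R)
  then show ?case
    by (cases R) (auto intro: run.run_snoc step_seq step_seq_done)
qed

text \<open>The state of a parallel composition in terms of the states of its sides.
  \<open>None\<close> is a neutral element, because a finished side is dropped.\<close>

fun par_result :: "command option \<Rightarrow> command option \<Rightarrow> command option" where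
  "par_result None R2 = R2"
| "par_result R1 None = R1"
| "par_result (Some C1) (Some C2) = Some (Par C1 C2)"

lemma par_result_None [simp]: "par_result R None = R"
  by (cases R) auto

text \<open>This treats a move on the left uniformly. If the right side is still active, the step is
  lifted by a rule for \<open>Par\<close>; if it has finished, only the left command remains and
  makes the step itself.\<close>

lemma run_par_resultL:
  assumes "run C w (par_result (Some C1) R2)" and "step C1 l R1"
  shows "run C (w @ [l]) (par_result R1 R2)"
  using assms by (cases R1; cases R2) (auto intro: run_snoc step_parL step_parL_done)

lemma run_par_resultR:
  assumes "run C w (par_result R1 (Some C2))" and "step C2 l R2"
  shows "run C (w @ [l]) (par_result R1 R2)"
  using assms by (cases R1; cases R2) (auto intro: run_snoc step_parR step_parR_done)

text \<open>\<open>steps\<close> grows at the front and \<open>run\<close> at the end; this bridges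
  the two.\<close>

lemma steps_snoc: "steps C w R \<Longrightarrow> R = Some C' \<Longrightarrow> step C' l R' \<Longrightarrow> steps C (w @ [l]) R'"
  by (induction rule: steps.induct) (auto intro: steps_one steps_more)

lemma run_imp_steps: "run C w R \<Longrightarrow> w \<noteq> [] \<Longrightarrow> steps C w R"
proof (induction rule: run.induct)
  case (run_snoc C w C' l R)
  then show ?case
    by (cases "w = []") (auto elim: run_NilE intro: steps_one steps_snoc)
qed simp


section \<open>Configurations and traces of event structures\<close>

lemma configurationI:
  assumes "\<And>e. e \<in> x \<Longrightarrow> e \<in> events S"
    and "\<And>d e. e \<in> x \<Longrightarrow> (d, e) \<in> causal S \<Longrightarrow> d \<in> x"
    and "\<And>d e. d \<in> x \<Longrightarrow> e \<in> x \<Longrightarrow> (d, e) \<notin> conflict S"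
  shows "configuration S x"
  using assms unfolding configuration_def by blast

lemma configurationD:
  assumes "configuration S x"
  shows "e \<in> x \<Longrightarrow> e \<in> events S"
    and "e \<in> x \<Longrightarrow> (d, e) \<in> causal S \<Longrightarrow> d \<in> x"
    and "d \<in> x \<Longrightarrow> e \<in> x \<Longrightarrow> (d, e) \<notin> conflict S"
  using assms unfolding configuration_def by blast+

lemma maximal_configurationD:
  "maximal_configuration S x \<Longrightarrow> configuration S y \<Longrightarrow> x \<subseteq> y \<Longrightarrow> y = x"
  unfolding maximal_configuration_def by blast

text \<open>A covering chain with its sets left out: they are recovered as the sets of the prefixes
  of the event list.\<close>

inductive trace :: "('e, 'm) es_scheme \<Rightarrow> 'e list \<Rightarrow> bool" for S where
  trace_Nil: "trace S []"
| trace_snoc: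
    "trace S es \<Longrightarrow> e \<notin> set es \<Longrightarrow> configuration S (insert e (set es)) \<Longrightarrow> trace S (es @ [e])"

lemma configuration_trace: "trace S es \<Longrightarrow> configuration S (set es)"
  by (erule trace.cases) (auto simp: configuration_def)

text \<open>The induction on \<open>k\<close> carries along that the \<open>k\<close>-th set of the
  chain consists of the first \<open>k\<close> added events.\<close>

lemma covering_chain_trace:
  assumes "covering_chain S xs es x"
  shows "trace S es"
proof -
  have "trace S (take k es) \<and> set (take k es) = xs ! k" if "k \<le> length es" for k
    using that
  proof (induction k)
    case 0
    then show ?case
      using assms by (cases xs) (auto simp: covering_chain_def trace_Nil)
  next
    case (Suc k)
    then have "configuration S (xs ! Suc k)" "es ! k \<notin> xs ! k"
      "xs ! Suc k = insert (es ! k) (xs ! k)"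
      using assms nth_mem[of "Suc k" xs] by (auto simp: covering_chain_def simp del: nth_mem)
    with Suc trace_snoc[of S "take k es" "es ! k"] show ?case
      by (simp add: take_Suc_conv_app_nth)
  qed
  from this[of "length es"] show ?thesis
    by simp
qed

section \<open>Structures with a single event\<close>

lemma trace_single:
  assumes "trace (single_ues e A) es"
  shows "es = [] \<or> es = [e]"
  using assms
  by (induction rule: trace.induct) (auto simp: configuration_def single_ues_def)

text \<open>The empty run has not terminated, so the empty trace must not exhaust a maximal
  configuration.\<close>

lemma not_maximal_single: "\<not> maximal_configuration (single_ues e A) {}"
  by (auto simp: maximal_configuration_def configuration_def single_ues_def
      intro!: exI[of _ "{e}"])

section \<open>Sequential composition\<close>

lemma events_seq [simp]:
  "SeqL a \<in> events (seq_ues S1 S2) \<longleftrightarrow> a \<in> events S1"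
  "SeqR e X \<in> events (seq_ues S1 S2) \<longleftrightarrow>
     e \<in> events S2 \<and> maximal_configuration S1 (fset X)"
  by (auto simp: seq_ues_def Let_def)

lemma events_seq_cases:
  assumes "e \<in> events (seq_ues S1 S2)"
  obtains a where "e = SeqL a" | d X where "e = SeqR d X"
  using assms by (auto simp: seq_ues_def Let_def)

text \<open>Only the upper event has its constructor fixed, since down-closure asks for all
  predecessors of a given event.\<close>

lemma causal_seq:
  "(d, SeqL b) \<in> causal (seq_ues S1 S2) \<longleftrightarrow> (\<exists>a. d = SeqL a \<and> (a, b) \<in> causal S1)"
  "(d, SeqR e X) \<in> causal (seq_ues S1 S2) \<longleftrightarrow> maximal_configuration S1 (fset X) \<and>
     ((\<exists>a. d = SeqL a \<and> a |\<in>| X \<and> e \<in> events S2) \<or>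
      (\<exists>d'. d = SeqR d' X \<and> (d', e) \<in> causal S2))"
  by (auto simp: seq_ues_def Let_def)

lemma conflict_seq:
  "(SeqL a, SeqL b) \<in> conflict (seq_ues S1 S2) \<longleftrightarrow> (a, b) \<in> conflict S1"
  "(SeqL a, SeqR e X) \<in> conflict (seq_ues S1 S2) \<longleftrightarrow>
     e \<in> events S2 \<and> maximal_configuration S1 (fset X) \<and>
     (\<exists>b. b |\<in>| X \<and> (a, b) \<in> conflict S1)"
  "(SeqR e X, SeqL a) \<in> conflict (seq_ues S1 S2) \<longleftrightarrow>
     e \<in> events S2 \<and> maximal_configuration S1 (fset X) \<and>
     (\<exists>b. b |\<in>| X \<and> (b, a) \<in> conflict S1)"
  "(SeqR d X, SeqR e Y) \<in> conflict (seq_ues S1 S2) \<longleftrightarrow>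
     (X = Y \<and> (d, e) \<in> conflict S2 \<and> maximal_configuration S1 (fset X)) \<or>
     (d \<in> events S2 \<and> e \<in> events S2 \<and>
      maximal_configuration S1 (fset X) \<and> maximal_configuration S1 (fset Y) \<and>
      (\<exists>a b. a |\<in>| X \<and> b |\<in>| Y \<and> (a, b) \<in> conflict S1))"
  by (simp_all add: seq_ues_def Let_def) blast+

lemma configuration_seqL:
  assumes "configuration (seq_ues S1 S2) y"
  shows "configuration S1 {a. SeqL a \<in> y}"
proof (rule configurationI, unfold mem_Collect_eq)
  show "a \<in> events S1" if "SeqL a \<in> y" for a
    using configurationD(1)[OF assms that] by simp
  show "SeqL d \<in> y" if "SeqL a \<in> y" "(d, a) \<in> causal S1" for a d
    using configurationD(2)[OF assms that(1)] that(2) by (simp add: causal_seq)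
  show "(d, a) \<notin> conflict S1" if "SeqL d \<in> y" "SeqL a \<in> y" for a d
    using configurationD(3)[OF assms that] by (simp add: conflict_seq)
qed

text \<open>For a maximal configuration \<open>X\<close>, the events tagged with \<open>X\<close>
  form a copy of the second structure. For any other \<open>X\<close> there are no such events and
  the set is empty.\<close>

lemma configuration_seqR:
  assumes "configuration (seq_ues S1 S2) y"
  shows "configuration S2 {e. SeqR e X \<in> y}"
proof (rule configurationI, unfold mem_Collect_eq)
  have ev: "a \<in> events S2 \<and> maximal_configuration S1 (fset X)" if "SeqR a X \<in> y" for a
    using configurationD(1)[OF assms that] by simp
  then show "a \<in> events S2" if "SeqR a X \<in> y" for a
    using that by simp
  show "SeqR d X \<in> y" if "SeqR a X \<in> y" "(d, a) \<in> causal S2" for a d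
    using configurationD(2)[OF assms that(1)] ev[OF that(1)] that(2) by (simp add: causal_seq)
  show "(d, a) \<notin> conflict S2" if "SeqR d X \<in> y" "SeqR a X \<in> y" for a d
    using configurationD(3)[OF assms that] ev[OF that(1)] by (simp add: conflict_seq)
qed

text \<open>All of \<open>X\<close> lies below \<open>SeqR e X\<close>, hence in the left part of
  \<open>y\<close>. That part is itself a configuration, so maximality of \<open>X\<close> forces
  equality. Thus all right events of \<open>y\<close> carry the same tag.\<close>

lemma configuration_seq_maximal:
  assumes "configuration (seq_ues S1 S2) y" and "SeqR e X \<in> y"
  shows "maximal_configuration S1 (fset X)" and "fset X = {a. SeqL a \<in> y}"
proof -
  have X: "maximal_configuration S1 (fset X)" "e \<in> events S2"
    using configurationD(1)[OF assms] by simp_all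
  then have "fset X \<subseteq> {a. SeqL a \<in> y}"
    using configurationD(2)[OF assms] by (auto simp: causal_seq)
  with X configuration_seqL[OF assms(1)]
  show "maximal_configuration S1 (fset X)" "fset X = {a. SeqL a \<in> y}"
    unfolding maximal_configuration_def by blast+
qed

lemma configuration_SeqL:
  assumes "configuration S1 y"
  shows "configuration (seq_ues S1 S2) (SeqL ` y)"
proof (rule configurationI)
  show "e \<in> events (seq_ues S1 S2)" if "e \<in> SeqL ` y" for e
    using that by (auto dest: configurationD(1)[OF assms])
  show "d \<in> SeqL ` y" if "e \<in> SeqL ` y" "(d, e) \<in> causal (seq_ues S1 S2)" for d e
    using that by (clarsimp simp: causal_seq image_iff) (erule (1) configurationD(2)[OF assms])
  show "(d, e) \<notin> conflict (seq_ues S1 S2)" if "d \<in> SeqL ` y" "e \<in> SeqL ` y" for d e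
    using that by (auto simp: conflict_seq dest: configurationD(3)[OF assms])
qed

text \<open>Together with \<open>configuration_SeqL\<close>, this builds the larger configurations
  against which maximality of a compound configuration is tested.\<close>

lemma configuration_SeqL_SeqR:
  assumes "maximal_configuration S1 (fset X)" and "configuration S2 y"
  shows "configuration (seq_ues S1 S2) (SeqL ` fset X \<union> (\<lambda>e. SeqR e X) ` y)"
proof (rule configurationI)
  have X: "configuration S1 (fset X)"
    using assms(1) by (simp add: maximal_configuration_def)
  show "e \<in> events (seq_ues S1 S2)" if "e \<in> SeqL ` fset X \<union> (\<lambda>e. SeqR e X) ` y" for e
    using that assms(1) by (auto dest: configurationD(1)[OF X] configurationD(1)[OF assms(2)])
  show "d \<in> SeqL ` fset X \<union> (\<lambda>e. SeqR e X) ` y"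
    if e: "e \<in> SeqL ` fset X \<union> (\<lambda>e. SeqR e X) ` y"
      and d: "(d, e) \<in> causal (seq_ues S1 S2)" for d e
  proof -
    consider a where "e = SeqL a" "a \<in> fset X" | b where "e = SeqR b X" "b \<in> y"
      using e by blast
    then show ?thesis
    proof cases
      case 1
      then obtain a' where "d = SeqL a'" "(a', a) \<in> causal S1"
        using d by (auto simp: causal_seq)
      then show ?thesis
        using configurationD(2)[OF X 1(2)] by simp
    next
      case 2
      then consider a where "d = SeqL a" "a \<in> fset X" | b' where "d = SeqR b' X" "(b', b) \<in> causal S2"
        using d by (auto simp: causal_seq)
      then show ?thesis
        using configurationD(2)[OF assms(2) 2(2)] by cases simp_all
    qed
  qed
  show "(d, e) \<notin> conflict (seq_ues S1 S2)"
    if "d \<in> SeqL ` fset X \<union> (\<lambda>e. SeqR e X) ` y" "e \<in> SeqL ` fset X \<union> (\<lambda>e. SeqR e X) ` y" for d e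
    using that
    by (auto simp: conflict_seq dest: configurationD(3)[OF X] configurationD(3)[OF assms(2)])
qed

text \<open>A right event requires a maximal configuration of left events to have occurred. So all
  left events come first, and their set is the tag of every right event.\<close>

lemma trace_seq:
  assumes "trace (seq_ues S1 S2) es"
  shows "\<exists>es1 es2. es = map SeqL es1 @ map (\<lambda>e. SeqR e (fset_of_list es1)) es2 \<and>
    trace S1 es1 \<and> trace S2 es2 \<and> (es2 \<noteq> [] \<longrightarrow> maximal_configuration S1 (set es1))"
  using assms
proof (induction rule: trace.induct)
  case trace_Nil
  show ?case
    by (rule exI[of _ "[]"], rule exI[of _ "[]"]) (simp add: trace.trace_Nil)
next
  case (trace_snoc es e)
  from trace_snoc.IH obtain es1 es2 where
    es: "es = map SeqL es1 @ map (\<lambda>e. SeqR e (fset_of_list es1)) es2"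
    and tr: "trace S1 es1" "trace S2 es2"
    and max: "es2 \<noteq> [] \<longrightarrow> maximal_configuration S1 (set es1)"
    by blast
  let ?y = "insert e (set es)"
  consider a where "e = SeqL a" | d X where "e = SeqR d X"
    using configurationD(1)[OF trace_snoc.hyps(3)] by (blast elim: events_seq_cases)
  then show ?case
  proof cases
    case 1
    have L: "{a. SeqL a \<in> ?y} = insert a (set es1)"
      by (auto simp: 1 es)
    then have conf: "configuration S1 (insert a (set es1))"
      using configuration_seqL[OF trace_snoc.hyps(3)] by simp
    have new: "a \<notin> set es1"
      using trace_snoc.hyps(2) by (auto simp: 1 es)
    \<comment> \<open>If a right event had already occurred, \<open>set es1\<close> would be
      maximal, yet adding \<open>a\<close> gives a strictly larger configuration.\<close>
    then have "es2 = []"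
      using max conf unfolding maximal_configuration_def by blast
    then show ?thesis
      using trace.trace_snoc[OF tr(1) new conf] tr(2)
      by (intro exI[of _ "es1 @ [a]"] exI[of _ "[]"]) (simp add: es 1)
  next
    case 2
    have "{a. SeqL a \<in> ?y} = set es1"
      by (auto simp: 2 es)
    \<comment> \<open>The new event is a right event, so its tag is the whole left part of the
      configuration, which \<open>e\<close> does not change.\<close>
    then have X: "fset X = set es1" and max': "maximal_configuration S1 (set es1)"
      using configuration_seq_maximal[OF trace_snoc.hyps(3), of d X] by (auto simp: 2)
    have Xeq: "X = fset_of_list es1"
      using X by (simp add: fset_inject[symmetric] fset_of_list.rep_eq)
    have "{e. SeqR e X \<in> ?y} = insert d (set es2)"
      by (auto simp: 2 es Xeq)
    then have conf: "configuration S2 (insert d (set es2))"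
      using configuration_seqR[OF trace_snoc.hyps(3), of X] by simp
    have new: "d \<notin> set es2"
      using trace_snoc.hyps(2) by (auto simp: 2 es Xeq)
    show ?thesis
      using trace.trace_snoc[OF tr(2) new conf] tr(1) max'
      by (intro exI[of _ es1] exI[of _ "es2 @ [d]"]) (simp add: es 2 Xeq)
  qed
qed

text \<open>A proper extension of a component would extend the compound configuration. Extending the
  left part this way needs \<open>y\<close> to be empty; otherwise its maximality is the last
  assumption.\<close>

lemma maximal_configuration_seq:
  assumes max: "maximal_configuration (seq_ues S1 S2)
      (SeqL ` fset X \<union> (\<lambda>e. SeqR e X) ` y)" (is "maximal_configuration _ ?z")
    and conf: "configuration S1 (fset X)" "configuration S2 y"
    and y: "y \<noteq> {} \<longrightarrow> maximal_configuration S1 (fset X)"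
  shows "maximal_configuration S1 (fset X)" and "maximal_configuration S2 y"
proof -
  show *: "maximal_configuration S1 (fset X)"
  proof (cases "y = {}")
    case True
    have "z = fset X" if "configuration S1 z" "fset X \<subseteq> z" for z
    proof -
      have "SeqL ` z = ?z"
        by (rule maximal_configurationD[OF max configuration_SeqL[OF that(1)]])
          (use that(2) True in auto)
      \<comment> \<open>Preimages under the injective constructor turn the equality of images into
        \<open>z = fset X\<close>.\<close>
      from arg_cong[OF this, of "\<lambda>A. {a. SeqL a \<in> A}"] show ?thesis
        using True by (simp add: image_iff)
    qed
    then show ?thesis
      using conf by (auto simp: maximal_configuration_def)
  qed (use y in simp)
  have "z = y" if z: "configuration S2 z" "y \<subseteq> z" for z
  proof -
    have "SeqL ` fset X \<union> (\<lambda>e. SeqR e X) ` z = ?z"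
      by (rule maximal_configurationD[OF max configuration_SeqL_SeqR[OF * z(1)]])
        (use z(2) in auto)
    from arg_cong[OF this, of "\<lambda>A. {e. SeqR e X \<in> A}"] show ?thesis
      by (simp add: image_iff)
  qed
  then show "maximal_configuration S2 y"
    using conf by (auto simp: maximal_configuration_def)
qed

section \<open>Measurement\<close>

lemma events_meas [simp]:
  "ProjE b m \<in> events (meas_ues N n S1 S2) \<longleftrightarrow> m = n"
  "Branch b d \<in> events (meas_ues N n S1 S2) \<longleftrightarrow> d \<in> events (if b then S2 else S1)"
  by (cases b; auto simp: meas_ues_def Let_def)+

lemma events_meas_cases:
  assumes "e \<in> events (meas_ues N n S1 S2)"
  obtains b where "e = ProjE b n" | b d where "e = Branch b d"
  using assms by (auto simp: meas_ues_def Let_def)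

lemma causal_meas:
  "(d, ProjE b m) \<in> causal (meas_ues N n S1 S2) \<longleftrightarrow> m = n \<and> d = ProjE b n"
  "(d, Branch b e) \<in> causal (meas_ues N n S1 S2) \<longleftrightarrow>
     (d = ProjE b n \<and> e \<in> events (if b then S2 else S1)) \<or>
     (\<exists>d'. d = Branch b d' \<and> (d', e) \<in> causal (if b then S2 else S1))"
  by (cases b; auto simp: meas_ues_def Let_def)+

lemma conflict_meas:
  "(ProjE b n, ProjE c n) \<in> conflict (meas_ues N n S1 S2) \<longleftrightarrow> b \<noteq> c"
  "(ProjE b n, Branch c e) \<in> conflict (meas_ues N n S1 S2) \<longleftrightarrow>
     b \<noteq> c \<and> e \<in> events (if c then S2 else S1)"
  "(Branch c e, ProjE b n) \<in> conflict (meas_ues N n S1 S2) \<longleftrightarrow>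
     b \<noteq> c \<and> e \<in> events (if c then S2 else S1)"
  "(Branch b d, Branch b e) \<in> conflict (meas_ues N n S1 S2) \<longleftrightarrow>
     (d, e) \<in> conflict (if b then S2 else S1)"
  by (cases b; cases c; auto simp: meas_ues_def Let_def)+

lemma configuration_meas_branch:
  assumes "configuration (meas_ues N n S1 S2) y"
  shows "configuration (if b then S2 else S1) {d. Branch b d \<in> y}" (is "configuration ?S _")
proof (rule configurationI, unfold mem_Collect_eq)
  show "d \<in> events ?S" if "Branch b d \<in> y" for d
    using configurationD(1)[OF assms that] by simp
  show "Branch b d \<in> y" if "Branch b e \<in> y" "(d, e) \<in> causal ?S" for d e
    using configurationD(2)[OF assms that(1)] that(2) by (simp add: causal_meas)
  show "(d, e) \<notin> conflict ?S" if "Branch b d \<in> y" "Branch b e \<in> y" for d e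
    using configurationD(3)[OF assms that] by (simp add: conflict_meas)
qed

text \<open>Every event has the projection event of its side below it, so down-closure puts that
  event into \<open>y\<close>. The two projection events are in conflict, so only one side can
  occur.\<close>

lemma configuration_meas_cases:
  assumes "configuration (meas_ues N n S1 S2) y" and "y \<noteq> {}"
  shows "\<exists>b. ProjE b n \<in> y \<and> y \<subseteq> insert (ProjE b n) (range (Branch b))"
proof -
  have side: "\<exists>b. ProjE b n \<in> y \<and> (e = ProjE b n \<or> e \<in> range (Branch b))" if "e \<in> y" for e
    using configurationD(1)[OF assms(1) that]
  proof (cases rule: events_meas_cases)
    case (1 b)
    then show ?thesis
      using that by blast
  next
    case (2 b d)
    then have "(ProjE b n, e) \<in> causal (meas_ues N n S1 S2)"
      using configurationD(1)[OF assms(1) that] by (simp add: causal_meas)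
    then show ?thesis
      using configurationD(2)[OF assms(1) that] 2 by blast
  qed
  then obtain b where b: "ProjE b n \<in> y"
    using assms(2) by blast
  have same: "c = b" if "ProjE c n \<in> y" for c
    using configurationD(3)[OF assms(1) that b] by (simp add: conflict_meas)
  have "y \<subseteq> insert (ProjE b n) (range (Branch b))"
  proof
    fix e
    assume "e \<in> y"
    then obtain c where "ProjE c n \<in> y" "e = ProjE c n \<or> e \<in> range (Branch c)"
      using side by blast
    then show "e \<in> insert (ProjE b n) (range (Branch b))"
      using same by simp
  qed
  with b show ?thesis
    by (intro exI conjI)
qed

lemma configuration_Branch:
  assumes "configuration (if b then S2 else S1) y" (is "configuration ?S y")
  shows "configuration (meas_ues N n S1 S2) (insert (ProjE b n) (Branch b ` y))"
proof (rule configurationI)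
  let ?z = "insert (ProjE b n) (Branch b ` y)"
  show "e \<in> events (meas_ues N n S1 S2)" if "e \<in> ?z" for e
    using that by (auto dest: configurationD(1)[OF assms] split del: if_split)
  show "d \<in> ?z" if d: "e \<in> ?z" "(d, e) \<in> causal (meas_ues N n S1 S2)" for d e
  proof -
    consider "d = ProjE b n"
      | d' e' where "d = Branch b d'" "e' \<in> y" "(d', e') \<in> causal ?S"
      using d by (auto simp: causal_meas split del: if_split)
    then show ?thesis
      using configurationD(2)[OF assms] by cases blast+
  qed
  show "(d, e) \<notin> conflict (meas_ues N n S1 S2)" if "d \<in> ?z" "e \<in> ?z" for d e
    using that by (auto simp: conflict_meas dest: configurationD(3)[OF assms] split del: if_split)
qed

text \<open>Every nonempty prefix is a configuration and contains a projection event, so the trace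
  starts with one. The following events stay on its side and form a trace of that branch.\<close>

lemma trace_meas:
  assumes "trace (meas_ues N n S1 S2) es"
  shows "es = [] \<or> (\<exists>b es'. es = ProjE b n # map (Branch b) es' \<and>
    trace (if b then S2 else S1) es')"
  using assms
proof (induction rule: trace.induct)
  case (trace_snoc es e)
  obtain b where b: "ProjE b n \<in> insert e (set es)"
    "insert e (set es) \<subseteq> insert (ProjE b n) (range (Branch b))"
    using configuration_meas_cases[OF trace_snoc.hyps(3)] by blast
  show ?case
  proof (cases "es = []")
    case True
    then show ?thesis
      using b by (auto intro: trace_Nil)
  next
    case False
    then obtain b' es' where es: "es = ProjE b' n # map (Branch b') es'"
      and tr: "trace (if b' then S2 else S1) es'"
      using trace_snoc.IH by blast
    have [simp]: "b' = b"
      using b(2) es by auto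
    \<comment> \<open>The projection event of this side already occurs in \<open>es\<close>, so the
      new event must come from the branch.\<close>
    obtain d where e: "e = Branch b d"
      using b(2) trace_snoc.hyps(2) es by auto
    have new: "d \<notin> set es'"
      using trace_snoc.hyps(2) by (auto simp: es e)
    have "{d. Branch b d \<in> insert e (set es)} = insert d (set es')"
      by (auto simp: es e)
    then have "configuration (if b then S2 else S1) (insert d (set es'))"
      using configuration_meas_branch[OF trace_snoc.hyps(3), of b] by simp
    from trace.trace_snoc[OF _ new this] tr show ?thesis
      by (intro disjI2 exI[of _ b] exI[of _ "es' @ [d]"]) (simp add: es e)
  qed
qed simp

text \<open>A single projection event, with nothing from its branch, is already a
  configuration.\<close>

lemma not_maximal_meas: "\<not> maximal_configuration (meas_ues N n S1 S2) {}"
proof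
  assume "maximal_configuration (meas_ues N n S1 S2) {}"
  moreover have "configuration (meas_ues N n S1 S2) {ProjE False n}"
    using configuration_Branch[of False S2 S1 "{}" N n] by (simp add: configuration_def)
  ultimately show False
    unfolding maximal_configuration_def by blast
qed

text \<open>A larger configuration of the branch would yield a larger one of the measurement, under
  the same projection event.\<close>

lemma maximal_configuration_meas:
  assumes max: "maximal_configuration (meas_ues N n S1 S2) (insert (ProjE b n) (Branch b ` y))"
    and conf: "configuration (if b then S2 else S1) y"
  shows "maximal_configuration (if b then S2 else S1) y"
proof -
  have "z = y" if z: "configuration (if b then S2 else S1) z" "y \<subseteq> z" for z
  proof -
    have "insert (ProjE b n) (Branch b ` z) = insert (ProjE b n) (Branch b ` y)"
      by (rule maximal_configurationD[OF max configuration_Branch[OF z(1)]])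
        (use z(2) in auto)
    from arg_cong[OF this, of "\<lambda>A. {d. Branch b d \<in> A}"] show ?thesis
      by (simp add: image_iff)
  qed
  then show ?thesis
    using conf by (simp add: maximal_configuration_def)
qed

section \<open>Parallel composition\<close>

lemma events_par [simp]:
  "ParL a \<in> events (par_ues S1 S2) \<longleftrightarrow> a \<in> events S1"
  "ParR a \<in> events (par_ues S1 S2) \<longleftrightarrow> a \<in> events S2"
  by (auto simp: par_ues_def)

lemma events_par_cases:
  assumes "e \<in> events (par_ues S1 S2)"
  obtains a where "e = ParL a" | a where "e = ParR a"
  using assms by (auto simp: par_ues_def)

lemma causal_par:
  "(d, ParL b) \<in> causal (par_ues S1 S2) \<longleftrightarrow> (\<exists>a. d = ParL a \<and> (a, b) \<in> causal S1)"
  "(d, ParR b) \<in> causal (par_ues S1 S2) \<longleftrightarrow> (\<exists>a. d = ParR a \<and> (a, b) \<in> causal S2)"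
  by (auto simp: par_ues_def)

lemma conflict_par:
  "(ParL a, ParL b) \<in> conflict (par_ues S1 S2) \<longleftrightarrow> (a, b) \<in> conflict S1"
  "(ParL a, ParR b) \<notin> conflict (par_ues S1 S2)"
  "(ParR a, ParL b) \<notin> conflict (par_ues S1 S2)"
  "(ParR a, ParR b) \<in> conflict (par_ues S1 S2) \<longleftrightarrow> (a, b) \<in> conflict S2"
  by (auto simp: par_ues_def)

text \<open>Neither causality nor conflict relates events of different sides, so both closure
  conditions can be checked on each side separately.\<close>

lemma configuration_par_iff:
  "configuration (par_ues S1 S2) y \<longleftrightarrow> y \<subseteq> events (par_ues S1 S2) \<and>
     configuration S1 {a. ParL a \<in> y} \<and> configuration S2 {a. ParR a \<in> y}"
proof (intro iffI conjI)
  assume y: "configuration (par_ues S1 S2) y"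
  show "y \<subseteq> events (par_ues S1 S2)"
    using y by (simp add: configuration_def)
  show "configuration S1 {a. ParL a \<in> y}"
  proof (rule configurationI, unfold mem_Collect_eq)
    show "a \<in> events S1" if "ParL a \<in> y" for a
      using configurationD(1)[OF y that] by simp
    show "ParL d \<in> y" if "ParL a \<in> y" "(d, a) \<in> causal S1" for a d
      using configurationD(2)[OF y that(1)] that(2) by (simp add: causal_par)
    show "(d, a) \<notin> conflict S1" if "ParL d \<in> y" "ParL a \<in> y" for a d
      using configurationD(3)[OF y that] by (simp add: conflict_par)
  qed
  show "configuration S2 {a. ParR a \<in> y}"
  proof (rule configurationI, unfold mem_Collect_eq)
    show "a \<in> events S2" if "ParR a \<in> y" for a
      using configurationD(1)[OF y that] by simp
    show "ParR d \<in> y" if "ParR a \<in> y" "(d, a) \<in> causal S2" for a d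
      using configurationD(2)[OF y that(1)] that(2) by (simp add: causal_par)
    show "(d, a) \<notin> conflict S2" if "ParR d \<in> y" "ParR a \<in> y" for a d
      using configurationD(3)[OF y that] by (simp add: conflict_par)
  qed
next
  assume *: "y \<subseteq> events (par_ues S1 S2) \<and>
     configuration S1 {a. ParL a \<in> y} \<and> configuration S2 {a. ParR a \<in> y}"
  then have ev: "e \<in> events (par_ues S1 S2)" if "e \<in> y" for e
    using that by blast
  from * have L: "configuration S1 {a. ParL a \<in> y}" and R: "configuration S2 {a. ParR a \<in> y}"
    by simp_all
  show "configuration (par_ues S1 S2) y"
  proof (rule configurationI)
    show "e \<in> events (par_ues S1 S2)" if "e \<in> y" for e
      using ev that .
    show "d \<in> y" if e: "e \<in> y" and d: "(d, e) \<in> causal (par_ues S1 S2)" for d e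
      using ev[OF e]
    proof (cases rule: events_par_cases)
      case (1 a)
      with d obtain a' where "d = ParL a'" "(a', a) \<in> causal S1"
        by (auto simp: causal_par)
      then show ?thesis
        using configurationD(2)[OF L] e 1 by simp
    next
      case (2 a)
      with d obtain a' where "d = ParR a'" "(a', a) \<in> causal S2"
        by (auto simp: causal_par)
      then show ?thesis
        using configurationD(2)[OF R] e 2 by simp
    qed
    show "(d, e) \<notin> conflict (par_ues S1 S2)" if d: "d \<in> y" and e: "e \<in> y" for d e
      using ev[OF d]
    proof (cases rule: events_par_cases)
      case d: (1 a)
      show ?thesis
        using ev[OF e] by (cases rule: events_par_cases)
          (use configurationD(3)[OF L] that d in \<open>simp_all add: conflict_par\<close>)
    next
      case d: (2 a)
      show ?thesis
        using ev[OF e] by (cases rule: events_par_cases)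
          (use configurationD(3)[OF R] that d in \<open>simp_all add: conflict_par\<close>)
    qed
  qed
qed

lemmas configuration_parL = configuration_par_iff[THEN iffD1, THEN conjunct2, THEN conjunct1]
  and configuration_parR = configuration_par_iff[THEN iffD1, THEN conjunct2, THEN conjunct2]

lemma configuration_par:
  assumes "configuration S1 y1" and "configuration S2 y2"
  shows "configuration (par_ues S1 S2) (ParL ` y1 \<union> ParR ` y2)"
proof -
  have "{a. ParL a \<in> ParL ` y1 \<union> ParR ` y2} = y1" "{a. ParR a \<in> ParL ` y1 \<union> ParR ` y2} = y2"
    by (simp_all add: image_iff)
  moreover have "ParL ` y1 \<union> ParR ` y2 \<subseteq> events (par_ues S1 S2)"
    using assms by (auto dest: configurationD(1))
  ultimately show ?thesis
    using assms by (simp only: configuration_par_iff)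
qed

lemma maximal_configuration_par:
  assumes max: "maximal_configuration (par_ues S1 S2) (ParL ` y1 \<union> ParR ` y2)"
    and conf: "configuration S1 y1" "configuration S2 y2"
  shows "maximal_configuration S1 y1" and "maximal_configuration S2 y2"
proof -
  have *: "z1 = y1 \<and> z2 = y2"
    if "configuration S1 z1" "y1 \<subseteq> z1" "configuration S2 z2" "y2 \<subseteq> z2" for z1 z2
  proof -
    have "ParL ` z1 \<union> ParR ` z2 = ParL ` y1 \<union> ParR ` y2"
      by (rule maximal_configurationD[OF max configuration_par[OF that(1,3)]])
        (use that(2,4) in auto)
    from arg_cong[OF this, of "\<lambda>A. {a. ParL a \<in> A}"] arg_cong[OF this, of "\<lambda>A. {a. ParR a \<in> A}"]
    show ?thesis
      by (simp add: image_iff)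
  qed
  \<comment> \<open>For each claim one side is enlarged and the other is kept fixed.\<close>
  show "maximal_configuration S1 y1" "maximal_configuration S2 y2"
    using *[of _ y2] *[of y1] conf by (auto simp: maximal_configuration_def)
qed

text \<open>
  A trace of a parallel composition is an interleaving of traces \<open>es1\<close> and \<open>es2\<close>; all that is
  recorded of the interleaving is that it lets runs over \<open>es1\<close> and \<open>es2\<close> be merged.
\<close>

lemma trace_par:
  assumes "trace (par_ues S1 S2) es"
  shows "\<exists>es1 es2. trace S1 es1 \<and> trace S2 es2 \<and>
    set es = ParL ` set es1 \<union> ParR ` set es2 \<and>
    (\<forall>C1 C2 R1 R2. run C1 (map event_label es1) R1 \<longrightarrow> run C2 (map event_label es2) R2 \<longrightarrow>
       run (Par C1 C2) (map event_label es) (par_result R1 R2))"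
  using assms
proof (induction rule: trace.induct)
  case trace_Nil
  \<comment> \<open>Empty runs leave both commands unchanged, and \<open>par_result\<close> of the
    two is then \<open>Par C1 C2\<close>.\<close>
  have "run (Par C1 C2) [] (par_result R1 R2)" if "run C1 [] R1" "run C2 [] R2" for C1 C2 R1 R2
    using that by (auto elim!: run_NilE intro: run_Nil)
  then show ?case
    by (intro exI[of _ "[]"]) (simp add: trace.trace_Nil)
next
  case (trace_snoc es e)
  from trace_snoc.IH obtain es1 es2 where
    tr: "trace S1 es1" "trace S2 es2" and es: "set es = ParL ` set es1 \<union> ParR ` set es2"
    and merge: "\<forall>C1 C2 R1 R2. run C1 (map event_label es1) R1 \<longrightarrow>
       run C2 (map event_label es2) R2 \<longrightarrow>
       run (Par C1 C2) (map event_label es) (par_result R1 R2)"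
    by (elim exE conjE) (rule that)
  let ?y = "insert e (set es)"
  consider a where "e = ParL a" | a where "e = ParR a"
    using configurationD(1)[OF trace_snoc.hyps(3)] by (blast elim: events_par_cases)
  then show ?case
  proof cases
    case 1
    have "{a. ParL a \<in> ?y} = insert a (set es1)"
      by (auto simp: 1 es)
    then have conf: "configuration S1 (insert a (set es1))"
      using configuration_parL[OF trace_snoc.hyps(3)] by simp
    have new: "a \<notin> set es1"
      using trace_snoc.hyps(2) by (auto simp: 1 es)
    show ?thesis
    proof (intro exI conjI allI impI)
      show "trace S1 (es1 @ [a])"
        using trace.trace_snoc[OF tr(1) new conf] .
      show "set (es @ [e]) = ParL ` set (es1 @ [a]) \<union> ParR ` set es2"
        by (simp add: es 1)
      fix C1 C2 R1 R2
      assume "run C1 (map event_label (es1 @ [a])) R1" and R2: "run C2 (map event_label es2) R2"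
      \<comment> \<open>The label of \<open>a\<close> is that of the last step on the left. The
        induction hypothesis merges the runs up to the state \<open>C1'\<close>, and this step is
        then made on the left of the merged state.\<close>
      then obtain C1' where "run C1 (map event_label es1) (Some C1')" "step C1' (event_label a) R1"
        by (auto elim: run_snocE)
      then show "run (Par C1 C2) (map event_label (es @ [e])) (par_result R1 R2)"
        by (auto simp: 1 intro: run_par_resultL merge[rule_format, OF _ R2])
    qed (fact tr(2))
  next
    case 2
    have "{a. ParR a \<in> ?y} = insert a (set es2)"
      by (auto simp: 2 es)
    then have conf: "configuration S2 (insert a (set es2))"
      using configuration_parR[OF trace_snoc.hyps(3)] by simp
    have new: "a \<notin> set es2"
      using trace_snoc.hyps(2) by (auto simp: 2 es)
    show ?thesis
    proof (intro exI conjI allI impI)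
      show "trace S2 (es2 @ [a])"
        using trace.trace_snoc[OF tr(2) new conf] .
      show "set (es @ [e]) = ParL ` set es1 \<union> ParR ` set (es2 @ [a])"
        by (simp add: es 2)
      fix C1 C2 R1 R2
      assume R1: "run C1 (map event_label es1) R1" and "run C2 (map event_label (es2 @ [a])) R2"
      then obtain C2' where "run C2 (map event_label es2) (Some C2')" "step C2' (event_label a) R2"
        by (auto elim: run_snocE)
      then show "run (Par C1 C2) (map event_label (es @ [e])) (par_result R1 R2)"
        by (auto simp: 2 intro: run_par_resultR merge[rule_format, OF R1])
    qed (fact tr(1))
  qed
qed

section \<open>Matching traces of the interpretation with runs\<close>

lemma run_single:
  assumes "trace (single_ues e A) es" and "step C (event_label e) None"
  shows "\<exists>R. run C (map event_label es) R \<and>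
    (maximal_configuration (single_ues e A) (set es) \<longrightarrow> R = None)"
  using trace_single[OF assms(1)]
proof
  assume "es = []"
  then show ?thesis
    using not_maximal_single by (auto intro: run_Nil)
next
  assume "es = [e]"
  then show ?thesis
    using run_snoc[OF run_Nil assms(2)] by auto
qed

lemma trace_run:
  assumes "trace (interp N C) es"
  shows "\<exists>R. run C (map event_label es) R \<and>
    (maximal_configuration (interp N C) (set es) \<longrightarrow> R = None)"
  using assms
proof (induction C arbitrary: es)
  case Skip
  then show ?case
    using run_single step_skip by simp
next
  case (Gate U ns)
  then show ?case
    using run_single step_gate by simp
next
  case (Seq C1 C2)
  from Seq.prems obtain es1 es2 where
    es: "es = map SeqL es1 @ map (\<lambda>e. SeqR e (fset_of_list es1)) es2"
    and tr: "trace (interp N C1) es1" "trace (interp N C2) es2"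
    and max: "es2 \<noteq> [] \<longrightarrow> maximal_configuration (interp N C1) (set es1)"
    using trace_seq[of "interp N C1" "interp N C2" es] by auto
  obtain R1 where R1: "run C1 (map event_label es1) R1"
    "maximal_configuration (interp N C1) (set es1) \<longrightarrow> R1 = None"
    using Seq.IH(1)[OF tr(1)] by blast
  obtain R2 where R2: "run C2 (map event_label es2) R2"
    "maximal_configuration (interp N C2) (set es2) \<longrightarrow> R2 = None"
    using Seq.IH(2)[OF tr(2)] by blast
  have labels: "map event_label es = map event_label es1 @ map event_label es2"
    by (simp add: es)
  show ?case
  \<comment> \<open>If the left events are maximal, the run of \<open>C1\<close> terminates, leaving
    \<open>C2\<close>, and the run over \<open>es2\<close> can be appended. Otherwise no right event
    has occurred and \<open>C1\<close> alone has moved.\<close>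
  proof (cases "maximal_configuration (interp N C1) (set es1)")
    case True
    then have "run (Seq C1 C2) (map event_label es1) (Some C2)"
      using R1 run_Seq[OF R1(1), of C2] by simp
    then have "run (Seq C1 C2) (map event_label es) R2"
      using run_append[OF R2(1)] labels by simp
    moreover have "maximal_configuration (interp N C2) (set es2)"
      if "maximal_configuration (interp N (Seq C1 C2)) (set es)"
      using maximal_configuration_seq(2)[of "interp N C1" "interp N C2" "fset_of_list es1" "set es2"]
        that True tr by (simp add: es fset_of_list.rep_eq configuration_trace)
    ultimately show ?thesis
      using R2(2) by blast
  next
    case False
    then have "es2 = []"
      using max by blast
    \<comment> \<open>Here the run ends in a command, so the termination clause must hold vacuously:
      a maximal compound configuration would have a maximal left part.\<close>
    moreover have "\<not> maximal_configuration (interp N (Seq C1 C2)) (set es)"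
      using maximal_configuration_seq(1)[of "interp N C1" "interp N C2" "fset_of_list es1" "set es2"]
        False max tr by (auto simp: es fset_of_list.rep_eq configuration_trace)
    ultimately show ?thesis
      using run_Seq[OF R1(1)] labels by auto
  qed
next
  case (Meas n C1 C2)
  let ?C = "\<lambda>b. if b then C2 else C1"
  \<comment> \<open>The interpretation is moved outside the conditional, so that the chosen branch
    is a command to which the induction hypotheses apply.\<close>
  have if_interp: "(if b then interp N C2 else interp N C1) = interp N (?C b)" for b
    by simp
  consider "es = []"
    | b es' where "es = ProjE b n # map (Branch b) es'" "trace (interp N (?C b)) es'"
    using trace_meas[of N n "interp N C1" "interp N C2" es] Meas.prems
    by (auto simp: if_interp)
  then show ?case
  proof cases
    case 1
    then show ?thesis
      using not_maximal_meas by (auto intro: run_Nil)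
  next
    case 2
    obtain R where R: "run (?C b) (map event_label es') R"
      "maximal_configuration (interp N (?C b)) (set es') \<longrightarrow> R = None"
      using 2(2) Meas.IH by (cases b) auto
    \<comment> \<open>The projection event that opens the trace has the label of the step into the
      chosen branch, whose run follows.\<close>
    have "step (Meas n C1 C2) (LProj b n) (Some (?C b))"
      by (cases b) (auto intro: step_meas0 step_meas1)
    then have "run (Meas n C1 C2) (map event_label es) R"
      using run_Cons[OF R(1)] by (simp add: 2(1) comp_def)
    moreover have "maximal_configuration (interp N (?C b)) (set es')"
      if "maximal_configuration (interp N (Meas n C1 C2)) (set es)"
      using maximal_configuration_meas[of N n "interp N C1" "interp N C2" b "set es'"]
        that configuration_trace[OF 2(2)] by (simp only: if_interp) (simp add: 2(1))
    ultimately show ?thesis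
      using R(2) by blast
  qed
next
  case (Par C1 C2)
  from Par.prems obtain es1 es2 where
    tr: "trace (interp N C1) es1" "trace (interp N C2) es2"
    and es: "set es = ParL ` set es1 \<union> ParR ` set es2"
    and merge: "\<forall>C1 C2 R1 R2. run C1 (map event_label es1) R1 \<longrightarrow>
       run C2 (map event_label es2) R2 \<longrightarrow>
       run (Par C1 C2) (map event_label es) (par_result R1 R2)"
    unfolding interp.simps by (elim exE[OF trace_par] exE conjE) (rule that)
  obtain R1 where R1: "run C1 (map event_label es1) R1"
    "maximal_configuration (interp N C1) (set es1) \<longrightarrow> R1 = None"
    using Par.IH(1)[OF tr(1)] by blast
  obtain R2 where R2: "run C2 (map event_label es2) R2"
    "maximal_configuration (interp N C2) (set es2) \<longrightarrow> R2 = None"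
    using Par.IH(2)[OF tr(2)] by blast
  \<comment> \<open>A maximal configuration of the composition is maximal on both sides, so both
    runs have terminated.\<close>
  have "par_result R1 R2 = None"
    if "maximal_configuration (interp N (Par C1 C2)) (set es)"
    using maximal_configuration_par[of "interp N C1" "interp N C2" "set es1" "set es2"]
      that R1(2) R2(2) tr by (simp add: es configuration_trace)
  then show ?case
    using merge[rule_format, OF R1(1) R2(1)] by blast
qed

theorem mainTheorem6:
  fixes N :: nat and C :: command and x :: "event set"
    and xs :: "event set list" and es :: "event list" and \<omega> :: "label list"
  assumes "wf_command N C"
    and "configuration (interp N C) x" and "finite x" and "x \<noteq> {}"
    and "covering_chain (interp N C) xs es x"
    and "\<omega> = map event_label es"
  shows "\<exists>C'. steps C \<omega> C'"
proof -
  \<comment> \<open>Without added events the chain would be the single set \<open>{}\<close>, which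
    would then equal \<open>x\<close>.\<close>
  have "es \<noteq> []"
    using assms(4,5) by (cases xs) (auto simp: covering_chain_def)
  moreover obtain R where "run C (map event_label es) R"
    using trace_run[OF covering_chain_trace[OF assms(5)]] by blast
  ultimately show ?thesis
    using run_imp_steps assms(6) by auto
qed

end
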